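(* Let $T$ be a $2$-sparse tree with $\ell\ge 2$ leaves. Then $P(G)=\ell-1$ for any graph $G\in\mathcal{G}(T)$.
   Context: Graphs are finite and simple. A path covering of a graph $G$ is a set of vertex-disjoint paths of $G$ (a single vertex counts as a path) containing all the vertices of $G$; the path covering number $P(G)$ is the minimum number of paths in a path covering of $G$. A leaf is a vertex of degree $1$. A graph is $2$-sparse if it contains no pair of adjacent vertices both of degree greater than $2$. For a nontrivial tree $T$, $\mathcal{G}(T)$ is the family of graphs obtained from $T$ by expanding each edge of $T$ into a complete graph of arbitrary order at least $2$: for each edge $e=uv$ one chooses an integer $t_e\ge 0$, adds $t_e$ new vertices $x_1,\dots,x_{t_e}$ (distinct for different edges), and makes $\{u,v,x_1,\dots,x_{t_e}\}$ a clique; no other edges are added. In particular $T\in\mathcal{G}(T)$. *)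

theory Defs
  imports "Graph_Theory.Graph_Theory" "HOL-Library.Disjoint_Sets"
begin

text \<open>
  A finite simple graph is a \<open>pair_graph\<close>: every undirected edge is stored as a pair of
  opposite arcs, so that the out-degree of a vertex is its degree.
\<close>

abbreviation degree :: "'a pair_pre_digraph \<Rightarrow> 'a \<Rightarrow> nat" where
  "degree G v \<equiv> out_degree (with_proj G) v"

definition edges :: "'a pair_pre_digraph \<Rightarrow> 'a set set" where
  "edges G = {{u, v} | u v. (u, v) \<in> parcs G}"

text \<open>
  The library predicate \<open>forest\<close> forbids all directed cycles, including the closed walks
  \<open>u, v, u\<close> of length 2 that every edge of a symmetric digraph yields. The cycles of a
  simple graph are those of length at least 3.
\<close>

definition undirected_tree :: "'a pair_pre_digraph \<Rightarrow> bool" where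
  "undirected_tree T \<longleftrightarrow>
     pair_graph T \<and> connected (with_proj T) \<and>
     \<not> (\<exists>p. pre_digraph.cycle (with_proj T) p \<and> 3 \<le> length p)"

definition leaves :: "'a pair_pre_digraph \<Rightarrow> 'a set" where
  "leaves G = {v \<in> pverts G. degree G v = 1}"

definition two_sparse :: "'a pair_pre_digraph \<Rightarrow> bool" where
  "two_sparse G \<longleftrightarrow> \<not> (\<exists>u v. (u, v) \<in> parcs G \<and> degree G u > 2 \<and> degree G v > 2)"

text \<open>
  A path is given by its list of vertices. A list and its reversal describe the same path, but
  disjointness prevents a covering from containing both, unless they are equal.
\<close>

definition path_covering :: "'a pair_pre_digraph \<Rightarrow> 'a list set \<Rightarrow> bool" where
  "path_covering G C \<longleftrightarrow>
     finite C \<and> (\<forall>p\<in>C. vpath p (with_proj G)) \<and> disjoint_family_on set C \<and>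
     (\<Union>p\<in>C. set p) = pverts G"

definition path_covering_number :: "'a pair_pre_digraph \<Rightarrow> nat" where
  "path_covering_number G = (LEAST k. \<exists>C. path_covering G C \<and> card C = k)"

text \<open>\<open>X e\<close> is the set of new vertices (possibly none) added to the edge \<open>e\<close>.\<close>

definition expand_edges :: "'a pair_pre_digraph \<Rightarrow> ('a set \<Rightarrow> 'a set) \<Rightarrow> 'a pair_pre_digraph" where
  "expand_edges T X =
     \<lparr> pverts = pverts T \<union> (\<Union>e\<in>edges T. X e),
       parcs = {(a, b). a \<noteq> b \<and> (\<exists>e\<in>edges T. a \<in> e \<union> X e \<and> b \<in> e \<union> X e)} \<rparr>"

definition clique_expansions :: "'a pair_pre_digraph \<Rightarrow> 'a pair_pre_digraph set" where
  "clique_expansions T =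
     {expand_edges T X | X.
        (\<forall>e\<in>edges T. finite (X e) \<and> X e \<inter> pverts T = {}) \<and> disjoint_family_on X (edges T)}"

lemma clique_expansions_refl:
  assumes "pair_graph T"
  shows "T \<in> clique_expansions T"
proof -
  interpret pair_graph T by fact
  have "parcs (expand_edges T (\<lambda>_. {})) = parcs T"
  proof (rule set_eqI, clarify)
    fix a b
    have "(a, b) \<in> parcs (expand_edges T (\<lambda>_. {})) \<longleftrightarrow>
        a \<noteq> b \<and> (\<exists>u v. (u, v) \<in> parcs T \<and> a \<in> {u, v} \<and> b \<in> {u, v})"
      unfolding expand_edges_def edges_def by auto
    also have "\<dots> \<longleftrightarrow> (a, b) \<in> parcs T"
      using pair_no_loops[of "(a, b)"] arcs_symmetric[of a b] arcs_symmetric[of b a] by auto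
    finally show "(a, b) \<in> parcs (expand_edges T (\<lambda>_. {})) \<longleftrightarrow> (a, b) \<in> parcs T" .
  qed
  then have "T = expand_edges T (\<lambda>_. {})"
    by (simp add: expand_edges_def)
  then show ?thesis
    unfolding clique_expansions_def by (auto simp: disjoint_family_on_def)
qed

lemma pair_graph_clique_expansions:
  assumes "pair_graph T" and "G \<in> clique_expansions T"
  shows "pair_graph G"
proof -
  interpret pair_graph T by fact
  obtain X where G: "G = expand_edges T X" and X: "\<And>e. e \<in> edges T \<Longrightarrow> finite (X e)"
    using assms(2) by (auto simp: clique_expansions_def)
  have "edges T = (\<lambda>(u, v). {u, v}) ` parcs T"
    by (auto simp: edges_def)
  then have fin: "finite (pverts G)"
    using X by (simp add: G expand_edges_def)
  have wf: "parcs G \<subseteq> pverts G \<times> pverts G"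
  proof (clarify, intro conjI)
    have sub: "e \<subseteq> pverts T" if "e \<in> edges T" for e
      using that in_arcsD1 in_arcsD2 by (auto simp: edges_def)
    fix a b
    assume "(a, b) \<in> parcs G"
    then obtain e where "e \<in> edges T" "a \<in> e \<union> X e" "b \<in> e \<union> X e"
      by (auto simp: G expand_edges_def)
    then show "a \<in> pverts G" and "b \<in> pverts G"
      using sub by (auto simp: G expand_edges_def)
  qed
  show ?thesis
  proof
    show "finite (parcs G)"
      using wf fin by (meson finite_SigmaI finite_subset)
    show "symmetric (with_proj G)"
      by (auto simp: symmetric_def arcs_ends_def arc_to_ends_def sym_def G expand_edges_def)
  qed (use wf fin in \<open>auto simp: G expand_edges_def\<close>)
qed

end

theory Submission
  imports Defs
begin

text \<open>
  Every nontrivial tree arises from a single edge by attaching leaves one at a time. Along this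
  construction a path covering with \<open>\<ell> - 1\<close> paths is maintained: a new leaf either extends the
  path that ends at its neighbour or starts a new path.

  Conversely, a covering with \<open>k\<close> paths has \<open>\<bar>V(G)\<bar> - k\<close> arcs. A block on \<open>n\<close> vertices contains at
  most \<open>n - 1\<close> of them, and at most \<open>n - 2\<close> if one of its vertices is isolated in it. A tree
  vertex of degree \<open>d > 2\<close> is isolated in at least \<open>d - 2\<close> of its blocks, and 2-sparseness prevents
  a block from being counted for two such vertices. As \<open>\<Sum>(n - 1) = \<bar>V(G)\<bar> - 1\<close>, this gives
  \<open>k \<ge> 1 + \<Sum>(d - 2)\<close>, which is \<open>\<ell> - 1\<close> by the handshake lemma.
\<close>

section \<open>Walks and paths as vertex lists\<close>

lemma mem_vwalk_arcs_iff:
  "(a, b) \<in> set (vwalk_arcs p) \<longleftrightarrow> (\<exists>ys zs. p = ys @ a # b # zs)"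
proof (induction p rule: vwalk_arcs.induct)
  case (3 x y xs)
  have "(\<exists>ys zs. x # y # xs = ys @ a # b # zs) \<longleftrightarrow>
      (x = a \<and> y = b) \<or> (\<exists>ys zs. y # xs = ys @ a # b # zs)"
    by (auto simp: Cons_eq_append_conv)
  with 3 show ?case
    by auto
qed (auto simp: Cons_eq_append_conv)

lemma vpath_mono:
  assumes "vpath p (with_proj H)" and "pverts H \<subseteq> pverts G" and "parcs H \<subseteq> parcs G"
  shows "vpath p (with_proj G)"
  using assms by (auto simp: vpath_def vwalk_def)

lemma vpath_append:
  assumes "vpath p G" and "vpath q G" and "(last p, hd q) \<in> arcs_ends G"
    and "set p \<inter> set q = {}"
  shows "vpath (p @ q) G"
  using assms by (auto simp: vpath_def vwalk_def vwalk_arcs_append)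

lemma clique_vpath:
  assumes "q \<noteq> []" and "distinct q" and "set q \<subseteq> verts G"
    and "\<And>a b. a \<in> set q \<Longrightarrow> b \<in> set q \<Longrightarrow> a \<noteq> b \<Longrightarrow> (a, b) \<in> arcs_ends G"
  shows "vpath q G"
proof -
  have "set (vwalk_arcs q) \<subseteq> arcs_ends G"
    using assms(2,4) by (auto simp: mem_vwalk_arcs_iff)
  then show ?thesis
    using assms by (auto simp: vpath_def vwalk_def)
qed

lemma vpath_rev:
  assumes "pair_graph G" and "vpath p (with_proj G)"
  shows "vpath (rev p) (with_proj G)"
proof -
  interpret pair_graph G by fact
  have "(a, b) \<in> parcs G" if ab: "(a, b) \<in> set (vwalk_arcs (rev p))" for a b
  proof -
    obtain ys zs where "rev p = ys @ a # b # zs"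
      using ab unfolding mem_vwalk_arcs_iff by blast
    then have "p = rev zs @ b # a # rev ys"
      by (simp add: rev_swap)
    then have "(b, a) \<in> set (vwalk_arcs p)"
      unfolding mem_vwalk_arcs_iff by blast
    then show ?thesis
      using assms(2) arcs_symmetric by (auto simp: vpath_def vwalk_def)
  qed
  then show ?thesis
    using assms(2) by (auto simp: vpath_def vwalk_def)
qed

text \<open>Translates vertex lists into the arc lists on which \<open>cycle\<close> is defined;
  this is how a closed vertex list becomes a forbidden cycle of a tree.\<close>

lemma awalk_of_vwalk:
  assumes "p \<noteq> []"
  shows "pcas (hd p) (vwalk_arcs p) (last p)"
    and "pawalk_verts (hd p) (vwalk_arcs p) = p"
  using assms by (induction p rule: vwalk_arcs.induct) auto

lemma degree_eq_card_image: "degree G v = card (parcs G `` {v})"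
proof -
  have "out_arcs (with_proj G) v = Pair v ` (parcs G `` {v})"
    by (auto simp: out_arcs_def)
  then show ?thesis
    by (simp add: out_degree_def card_image inj_on_def)
qed

section \<open>Trees grown by attaching leaves\<close>

definition add_leaf :: "'a pair_pre_digraph \<Rightarrow> 'a \<Rightarrow> 'a \<Rightarrow> 'a pair_pre_digraph" where
  "add_leaf T u w =
     \<lparr> pverts = insert w (pverts T), parcs = {(u, w), (w, u)} \<union> parcs T \<rparr>"

lemma add_leaf_simps [simp]:
  "pverts (add_leaf T u w) = insert w (pverts T)"
  "parcs (add_leaf T u w) = {(u, w), (w, u)} \<union> parcs T"
  by (simp_all add: add_leaf_def)

text \<open>The base is an edge and not a single vertex: every vertex then has a neighbour, and the
  base has two leaves and is covered by one path, as the count requires.\<close>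

inductive leaf_grown :: "'a pair_pre_digraph \<Rightarrow> bool" where
  edge: "u \<noteq> v \<Longrightarrow> leaf_grown \<lparr> pverts = {u, v}, parcs = {(u, v), (v, u)} \<rparr>"
| leaf: "leaf_grown T \<Longrightarrow> u \<in> pverts T \<Longrightarrow> w \<notin> pverts T \<Longrightarrow> leaf_grown (add_leaf T u w)"

lemma leaf_grown_pair_graph:
  assumes "leaf_grown T"
  shows "pair_graph T"
  using assms
proof induction
  case (edge u v)
  then show ?case
    by unfold_locales (auto simp: symmetric_def sym_def)
next
  case (leaf T u w)
  then interpret pair_graph T by simp
  show ?case
    using leaf.hyps pair_finite_verts pair_finite_arcs pair_no_loops arcs_symmetric
    by unfold_locales (auto simp: symmetric_def sym_def dest: in_arcsD1 in_arcsD2 no_loops')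
qed

lemma edges_add_leaf: "edges (add_leaf T u w) = insert {u, w} (edges T)"
  by (auto simp: edges_def insert_commute)

context pair_graph
begin

lemma edge_subset_verts: "e \<in> edges G \<Longrightarrow> e \<subseteq> pverts G"
  using in_arcsD1 in_arcsD2 by (auto simp: edges_def)

lemma card_edge: "e \<in> edges G \<Longrightarrow> card e = 2"
  using no_loops' by (auto simp: edges_def)

lemma finite_edges: "finite (edges G)"
proof -
  have "edges G = (\<lambda>(u, v). {u, v}) ` parcs G"
    by (auto simp: edges_def)
  then show ?thesis
    using pair_finite_arcs by simp
qed

lemma card_incident_edges: "card {e \<in> edges G. v \<in> e} = degree G v"
proof -
  have "{e \<in> edges G. v \<in> e} = (\<lambda>w. {v, w}) ` (parcs G `` {v})"
    using arcs_symmetric by (auto simp: edges_def insert_commute)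
  moreover have "inj_on (\<lambda>w. {v, w}) (parcs G `` {v})"
    by (auto simp: inj_on_def doubleton_eq_iff)
  ultimately show ?thesis
    by (simp add: degree_eq_card_image card_image)
qed

lemma sum_degree: "(\<Sum>v\<in>pverts G. degree G v) = card (parcs G)"
proof -
  have "parcs G = Sigma (pverts G) (\<lambda>v. parcs G `` {v})"
    using in_arcsD1 by auto
  moreover have "card (Sigma (pverts G) (\<lambda>v. parcs G `` {v})) = (\<Sum>v\<in>pverts G. degree G v)"
    using pair_finite_verts pair_finite_arcs
    by (simp add: degree_eq_card_image)
  ultimately show ?thesis
    by simp
qed

end

text \<open>Each new leaf brings one vertex, one edge and two arcs. The arc count is the degree sum
  of the handshake lemma.\<close>

lemma leaf_grown_card:
  assumes "leaf_grown T"
  shows "card (pverts T) = card (edges T) + 1 \<and> card (parcs T) = 2 * card (edges T)"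
  using assms
proof induction
  case (edge u v)
  have "edges \<lparr> pverts = {u, v}, parcs = {(u, v), (v, u)} \<rparr> = {{u, v}}"
    by (auto simp: edges_def)
  with edge show ?case
    by simp
next
  case (leaf T u w)
  then interpret pair_graph T by (simp add: leaf_grown_pair_graph)
  have "{u, w} \<notin> edges T" "(u, w) \<notin> parcs T" "(w, u) \<notin> parcs T" "u \<noteq> w"
    using leaf.hyps edge_subset_verts in_arcsD1 in_arcsD2 by auto
  then show ?case
    using leaf pair_finite_verts pair_finite_arcs finite_edges
    by (simp add: edges_add_leaf)
qed

lemma leaf_grown_has_neighbour:
  assumes "leaf_grown T" and "v \<in> pverts T"
  shows "\<exists>w. (v, w) \<in> parcs T"
  using assms by induction auto

text \<open>Supplies the path that closes up to a cycle when an outside vertex has two neighbours in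
  a grown subtree.\<close>

lemma leaf_grown_vpath:
  assumes "leaf_grown T" and "a \<in> pverts T" and "b \<in> pverts T"
  shows "\<exists>p. vpath p (with_proj T) \<and> hd p = a \<and> last p = b"
  using assms
proof (induction arbitrary: a b)
  case (edge u v)
  have "vpath (if a = b then [a] else [a, b])
      (with_proj \<lparr> pverts = {u, v}, parcs = {(u, v), (v, u)} \<rparr>)"
    using edge by (intro clique_vpath) auto
  then show ?case
    by (intro exI[of _ "if a = b then [a] else [a, b]"]) auto
next
  case (leaf T u w)
  let ?T = "add_leaf T u w"
  have w: "vpath [w] (with_proj ?T)"
    by (intro clique_vpath) auto
  \<comment> \<open>The bound on \<open>set p\<close> records that \<open>w\<close> is not on the
    path, so that \<open>w\<close> can be added at either end.\<close>
  have old: "\<exists>p. vpath p (with_proj ?T) \<and> set p \<subseteq> pverts T \<and> hd p = x \<and> last p = y"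
    if xy: "x \<in> pverts T" "y \<in> pverts T" for x y
  proof -
    obtain p where "vpath p (with_proj T)" "hd p = x" "last p = y"
      using leaf.IH[OF xy] by blast
    moreover from this have "set p \<subseteq> pverts T"
      by (auto simp: vpath_def vwalk_def)
    moreover have "vpath p (with_proj ?T)"
      using \<open>vpath p (with_proj T)\<close> by (rule vpath_mono) auto
    ultimately show ?thesis
      by blast
  qed
  consider "a = w" "b = w" | "a \<in> pverts T" "b = w" | "a = w" "b \<in> pverts T"
    | "a \<in> pverts T" "b \<in> pverts T"
    using leaf.prems by auto
  then show ?case
  proof cases
    case 1
    with w show ?thesis
      by (intro exI[of _ "[w]"]) auto
  next
    case 2
    with old leaf.hyps obtain p
      where p: "vpath p (with_proj ?T)" "set p \<subseteq> pverts T" "hd p = a" "last p = u"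
      by blast
    have "vpath (p @ [w]) (with_proj ?T)"
      using p w leaf.hyps by (intro vpath_append) auto
    moreover have "p \<noteq> []"
      using p by (auto simp: vpath_def)
    ultimately show ?thesis
      using p 2 by (intro exI[of _ "p @ [w]"]) auto
  next
    case 3
    with old leaf.hyps obtain p
      where p: "vpath p (with_proj ?T)" "set p \<subseteq> pverts T" "hd p = u" "last p = b"
      by blast
    have "vpath ([w] @ p) (with_proj ?T)"
      using p w leaf.hyps by (intro vpath_append) auto
    moreover have "p \<noteq> []"
      using p by (auto simp: vpath_def)
    ultimately show ?thesis
      using p 3 by (intro exI[of _ "w # p"]) auto
  next
    case 4
    with old show ?thesis
      by blast
  qed
qed

text \<open>A set that no arc leaves contains everything reachable from its elements. By symmetry of
  the arcs, connectedness makes all vertices reachable.\<close>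

lemma (in pair_graph) exists_arc_leaving:
  assumes "connected (with_proj G)" and "S \<subseteq> pverts G" and "S \<noteq> {}" and "S \<noteq> pverts G"
  shows "\<exists>s w. s \<in> S \<and> w \<in> pverts G - S \<and> (s, w) \<in> parcs G"
proof (rule ccontr)
  assume no: "\<not> ?thesis"
  obtain a b where ab: "a \<in> S" "b \<in> pverts G" "b \<notin> S"
    using assms(2-4) by blast
  have "strongly_connected (with_proj G)"
    using assms(1) sym_arcs symmetric_connected_imp_strongly_connected by simp
  then have "a \<rightarrow>\<^sup>*\<^bsub>with_proj G\<^esub> b"
    using ab assms(2) by (auto simp: strongly_connected_def)
  then have "b \<in> S"
  proof (induction rule: reachable_induct)
    case base
    show ?case by (fact ab)
  next
    case (step x y)
    then show ?case
      using no in_arcsD2 by auto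
  qed
  with ab show False
    by simp
qed

text \<open>A largest grown induced subgraph \<open>H\<close> is all of \<open>T\<close>. Otherwise
  an arc leaves \<open>H\<close> towards some \<open>w\<close>. A second neighbour of
  \<open>w\<close> in \<open>H\<close> would yield a cycle, so \<open>w\<close> can be attached as a
  leaf, against maximality.\<close>

lemma undirected_tree_leaf_grown:
  assumes T: "undirected_tree T" and ne: "parcs T \<noteq> {}"
  shows "leaf_grown T"
proof -
  interpret pair_graph T
    using T by (simp add: undirected_tree_def)
  define P where "P H \<longleftrightarrow> leaf_grown H \<and> pverts H \<subseteq> pverts T \<and>
    parcs H = parcs T \<inter> pverts H \<times> pverts H" for H
  obtain u v where uv: "(u, v) \<in> parcs T"
    using ne by auto
  have "u \<noteq> v" "{(u, v), (v, u)} = parcs T \<inter> {u, v} \<times> {u, v}"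
    using uv no_loops'[OF uv] no_loops'[of u u] no_loops'[of v v] arcs_symmetric[OF uv] by auto
  then have "P \<lparr> pverts = {u, v}, parcs = {(u, v), (v, u)} \<rparr>"
    using in_arcsD1[OF uv] in_arcsD2[OF uv] leaf_grown.edge[of u v] by (simp add: P_def)
  moreover have "\<forall>H. P H \<longrightarrow> card (pverts H) < Suc (card (pverts T))"
    using card_mono[OF pair_finite_verts] by (simp add: P_def less_Suc_eq_le)
  ultimately have "\<exists>H. P H \<and> (\<forall>H'. P H' \<longrightarrow> card (pverts H') \<le> card (pverts H))"
    by (rule ex_has_greatest_nat)
  then obtain H where H: "P H" and
    max: "\<And>H'. P H' \<Longrightarrow> card (pverts H') \<le> card (pverts H)"
    by blast
  have grown: "leaf_grown H" and sub: "pverts H \<subseteq> pverts T"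
    and induced: "parcs H = parcs T \<inter> pverts H \<times> pverts H"
    using H by (auto simp: P_def)
  have "pverts H = pverts T"
  proof (rule ccontr)
    assume neq: "pverts H \<noteq> pverts T"
    have "pverts H \<noteq> {}"
      using grown by cases auto
    then obtain s w where sw: "s \<in> pverts H" "w \<in> pverts T" "w \<notin> pverts H" "(s, w) \<in> parcs T"
      using exists_arc_leaving[OF _ sub] neq T by (auto simp: undirected_tree_def)
    have unique: "s' = s" if s': "s' \<in> pverts H" "(s', w) \<in> parcs T" for s'
    proof (rule ccontr)
      assume "s' \<noteq> s"
      obtain p where p: "vpath p (with_proj H)" "hd p = s" "last p = s'"
        using leaf_grown_vpath[OF grown sw(1) s'(1)] by blast
      have pH: "set p \<subseteq> pverts H" and "p \<noteq> []" and arcs: "set (vwalk_arcs p) \<subseteq> parcs T"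
        and "distinct p"
        using p(1) induced by (auto simp: vpath_def vwalk_def)
      have len: "2 \<le> length p"
        using p \<open>s' \<noteq> s\<close> \<open>p \<noteq> []\<close> by (cases p; cases "tl p") auto
      \<comment> \<open>The path from \<open>s\<close> to \<open>s'\<close> is closed through
        \<open>w\<close>. As \<open>p\<close> has at least two vertices, the walk has at least three
        arcs and is not a mere back-and-forth along an edge.\<close>
      let ?c = "w # p @ [w]"
      have arcs_c: "vwalk_arcs ?c = (w, s) # vwalk_arcs p @ [(s', w)]"
        using p \<open>p \<noteq> []\<close> by (simp add: vwalk_arcs_append)
      have "awalk w (vwalk_arcs ?c) w"
        using awalk_of_vwalk(1)[of ?c] sw s' arcs arcs_symmetric
        by (auto simp: awalk_def arcs_c)
      moreover have "distinct (tl (pawalk_verts w (vwalk_arcs ?c)))"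
        using awalk_of_vwalk(2)[of ?c] \<open>distinct p\<close> pH sw(3) by auto
      ultimately have "cycle (vwalk_arcs ?c)"
        unfolding cycle_def arcs_c by auto
      moreover have "3 \<le> length (vwalk_arcs ?c)"
        using len vwalk_length_simp[of ?c] unfolding vwalk_length_def by simp
      ultimately show False
        using T by (auto simp: undirected_tree_def)
    qed
    have "P (add_leaf H s w)"
      unfolding P_def
    proof (intro conjI)
      show "leaf_grown (add_leaf H s w)"
        using grown sw by (intro leaf_grown.leaf)
      show "pverts (add_leaf H s w) \<subseteq> pverts T"
        using sub sw by auto
      \<comment> \<open>As \<open>s\<close> is the only neighbour of \<open>w\<close> in
        \<open>H\<close>, the subgraph induced by the enlarged vertex set gains just the two arcs
        between \<open>s\<close> and \<open>w\<close>.\<close>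
      have "a \<in> pverts H \<and> (a, w) \<in> parcs T \<longleftrightarrow> a = s"
        and "a \<in> pverts H \<and> (w, a) \<in> parcs T \<longleftrightarrow> a = s" for a
        using unique sw(1,4) arcs_symmetric by blast+
      moreover have "(w, w) \<notin> parcs T"
        using no_loops' by blast
      ultimately have "(a, b) \<in> parcs (add_leaf H s w) \<longleftrightarrow>
          (a, b) \<in> parcs T \<inter> pverts (add_leaf H s w) \<times> pverts (add_leaf H s w)" for a b
        using sw(3) induced by (cases "a = w"; cases "b = w") auto
      then show "parcs (add_leaf H s w) =
          parcs T \<inter> pverts (add_leaf H s w) \<times> pverts (add_leaf H s w)"
        by (intro set_eqI) (simp only: split_paired_all)
    qed
    from max[OF this] show False
      using sw(3) finite_subset[OF sub pair_finite_verts] by simp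
  qed
  with induced have "H = T"
    using in_arcsD1 in_arcsD2 by (intro pair_pre_digraph.equality) auto
  with grown show ?thesis
    by simp
qed

text \<open>Since \<open>u\<close> already has a neighbour, its new degree is at least 2, so it is
  no leaf afterwards; an isolated \<open>u\<close> would become one.\<close>

lemma leaves_add_leaf:
  assumes "pair_graph T" and "u \<in> pverts T" and "w \<notin> pverts T" and "\<exists>x. (u, x) \<in> parcs T"
  shows "leaves (add_leaf T u w) = insert w (leaves T - {u})"
proof -
  interpret pair_graph T by fact
  have fin: "finite (parcs T `` {v})" for v
    using pair_finite_arcs by simp
  have "parcs (add_leaf T u w) `` {w} = {u}"
    using assms(2,3) in_arcsD1 by auto
  then have w: "degree (add_leaf T u w) w = 1"
    by (simp only: degree_eq_card_image) simp
  have "parcs (add_leaf T u w) `` {u} = insert w (parcs T `` {u})" "w \<notin> parcs T `` {u}"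
    using assms(2,3) in_arcsD2 by auto
  then have u: "degree (add_leaf T u w) u = Suc (card (parcs T `` {u}))"
    unfolding degree_eq_card_image using fin[of u] by (metis card_insert_disjoint)
  have "parcs T `` {u} \<noteq> {}"
    using assms(4) by auto
  with u fin have u': "degree (add_leaf T u w) u \<noteq> 1"
    by simp
  have "parcs (add_leaf T u w) `` {v} = parcs T `` {v}" if "v \<noteq> u" "v \<noteq> w" for v
    using that by auto
  then have other: "degree (add_leaf T u w) v = degree T v" if "v \<noteq> u" "v \<noteq> w" for v
    using that by (simp add: degree_eq_card_image del: add_leaf_simps)
  have "x \<in> leaves (add_leaf T u w) \<longleftrightarrow> x \<in> insert w (leaves T - {u})" for x
    using w u' other[of x] assms(2,3) by (cases "x = u"; cases "x = w") (auto simp: leaves_def)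
  then show ?thesis
    by blast
qed

section \<open>Clique expansions and the upper bound\<close>

lemma expand_edges_simps:
  "pverts (expand_edges T X) = pverts T \<union> (\<Union>e\<in>edges T. X e)"
  "(a, b) \<in> parcs (expand_edges T X) \<longleftrightarrow>
     a \<noteq> b \<and> (\<exists>e\<in>edges T. a \<in> e \<union> X e \<and> b \<in> e \<union> X e)"
  by (auto simp: expand_edges_def)

lemma pair_graph_expand_edges:
  assumes "pair_graph T" and "\<forall>e\<in>edges T. finite (X e) \<and> X e \<inter> pverts T = {}"
    and "disjoint_family_on X (edges T)"
  shows "pair_graph (expand_edges T X)"
  using assms(1)
proof (rule pair_graph_clique_expansions)
  show "expand_edges T X \<in> clique_expansions T"
    unfolding clique_expansions_def using assms(2,3) by blast
qed

text \<open>Blocks are cliques, so any order of distinct block vertices is a path.\<close>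

lemma expand_edges_clique_vpath:
  assumes "e \<in> edges T" and "e \<subseteq> pverts T" and "q \<noteq> []" and "distinct q"
    and "set q \<subseteq> e \<union> X e"
  shows "vpath q (with_proj (expand_edges T X))"
  using assms by (intro clique_vpath) (auto simp: expand_edges_simps)

lemma disjoint_family_on_insert_new:
  assumes "disjoint_family_on f I" and "\<And>i. i \<in> I \<Longrightarrow> f i \<inter> f k = {}"
  shows "disjoint_family_on f (insert k I)"
  using assms by (auto simp: disjoint_family_on_def)

lemma path_covering_insert:
  assumes "path_covering H C" and "pverts H \<subseteq> pverts G" and "parcs H \<subseteq> parcs G"
    and "vpath q (with_proj G)" and "set q \<inter> pverts H = {}"
    and "pverts G = pverts H \<union> set q"
  shows "path_covering G (insert q C)"
proof -
  have C: "finite C" "\<forall>p\<in>C. vpath p (with_proj H)" "disjoint_family_on set C"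
    "(\<Union>p\<in>C. set p) = pverts H"
    using assms(1) by (auto simp: path_covering_def)
  have "disjoint_family_on set (insert q C)"
    using C(3,4) assms(5) by (intro disjoint_family_on_insert_new) auto
  then show ?thesis
    using C assms vpath_mono[OF _ assms(2,3)] by (auto simp: path_covering_def)
qed

text \<open>The vertex to be extended may be either end of \<open>p\<close>; \<open>p'\<close> is
  \<open>p\<close> read in the direction that puts it last.\<close>

lemma path_covering_extend:
  assumes "path_covering H C" and "p \<in> C" and "pverts H \<subseteq> pverts G" and "parcs H \<subseteq> parcs G"
    and "p' = p \<or> p' = rev p" and "pair_graph H"
    and "vpath q (with_proj G)" and "(last p', hd q) \<in> parcs G" and "set q \<inter> pverts H = {}"
    and "pverts G = pverts H \<union> set q"
  shows "path_covering G (insert (p' @ q) (C - {p}))"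
proof -
  have C: "finite C" "\<forall>p\<in>C. vpath p (with_proj H)" "disjoint_family_on set C"
    "(\<Union>p\<in>C. set p) = pverts H"
    using assms(1) by (auto simp: path_covering_def)
  have set_p': "set p' = set p"
    using assms(5) by auto
  have pH: "set p \<subseteq> pverts H"
    using C(4) assms(2) by auto
  have "vpath p' (with_proj H)"
    using C(2) assms(2,5,6) vpath_rev by auto
  then have "vpath p' (with_proj G)"
    by (rule vpath_mono) fact+
  then have "vpath (p' @ q) (with_proj G)"
    using assms(7-9) pH set_p' by (intro vpath_append) auto
  moreover have "disjoint_family_on set (insert (p' @ q) (C - {p}))"
  proof (rule disjoint_family_on_insert_new)
    show "disjoint_family_on set (C - {p})"
      using C(3) by (rule disjoint_family_on_mono[rotated]) auto
    fix r assume r: "r \<in> C - {p}"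
    then have "set r \<inter> set p = {}"
      using C(3) assms(2) by (auto simp: disjoint_family_on_def)
    moreover have "set r \<inter> set q = {}"
      using C(4) r assms(9) by auto
    ultimately show "set r \<inter> set (p' @ q) = {}"
      using set_p' by auto
  qed
  moreover have "(\<Union>r\<in>insert (p' @ q) (C - {p}). set r) = pverts G"
    using C(4) assms(2,10) set_p' by auto
  ultimately show ?thesis
    using C(1,2) vpath_mono[OF _ assms(3,4)] by (auto simp: path_covering_def)
qed

text \<open>
  Demanding that every leaf of the tree is an end of a path lets the induction extend such a
  path when a new leaf is attached to an old one.
\<close>

lemma path_covering_upper:
  assumes "leaf_grown T" and "\<forall>e\<in>edges T. finite (X e) \<and> X e \<inter> pverts T = {}"
    and "disjoint_family_on X (edges T)"
  shows "\<exists>C. path_covering (expand_edges T X) C \<and> card C + 1 \<le> card (leaves T) \<and>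
    (\<forall>v\<in>leaves T. \<exists>p\<in>C. v = hd p \<or> v = last p)"
  using assms
proof (induction rule: leaf_grown.induct)
  case (edge u v)
  let ?T = "\<lparr> pverts = {u, v}, parcs = {(u, v), (v, u)} \<rparr>"
  have E: "edges ?T = {{u, v}}"
    by (auto simp: edges_def)
  have "parcs ?T `` {u} = {v}" "parcs ?T `` {v} = {u}"
    using edge.hyps by auto
  then have L: "leaves ?T = {u, v}"
    unfolding leaves_def degree_eq_card_image by auto
  have "finite (X {u, v})"
    using edge.prems E by simp
  then obtain xs where xs: "set xs = X {u, v}" "distinct xs"
    using finite_distinct_list by blast
  \<comment> \<open>One path runs through the whole block and ends at both leaves.\<close>
  let ?p = "u # xs @ [v]"
  have "vpath ?p (with_proj (expand_edges ?T X))"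
    using edge E xs by (intro expand_edges_clique_vpath[of "{u, v}"]) auto
  then have "path_covering (expand_edges ?T X) {?p}"
    using xs by (auto simp: path_covering_def expand_edges_simps E disjoint_family_on_def)
  then show ?case
    using edge.hyps by (intro exI[of _ "{?p}"]) (auto simp: L)
next
  case (leaf T u w)
  let ?T = "add_leaf T u w" and ?e = "{u, w}"
  let ?H = "expand_edges T X" and ?G = "expand_edges (add_leaf T u w) X"
  interpret pair_graph T
    using leaf.hyps(1) by (rule leaf_grown_pair_graph)
  have X: "\<forall>e\<in>edges T. finite (X e) \<and> X e \<inter> pverts T = {}" "disjoint_family_on X (edges T)"
    using leaf.prems by (auto simp: edges_add_leaf disjoint_family_on_def)
  have "pair_graph ?H"
    using pair_graph X by (rule pair_graph_expand_edges)
  obtain C where C: "path_covering ?H C" "card C + 1 \<le> card (leaves T)"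
    "\<forall>v\<in>leaves T. \<exists>p\<in>C. v = hd p \<or> v = last p"
    using leaf.IH[OF X] by blast
  have finC: "finite C" and nonempty: "\<And>p. p \<in> C \<Longrightarrow> p \<noteq> []"
    and coverC: "(\<Union>p\<in>C. set p) = pverts ?H"
    using C(1) by (auto simp: path_covering_def vpath_def)
  have L: "leaves ?T = insert w (leaves T - {u})"
    using leaf.hyps leaf_grown_has_neighbour by (intro leaves_add_leaf) auto
  have finL: "finite (leaves T)" and "w \<notin> leaves T"
    using pair_finite_verts leaf.hyps by (auto simp: leaves_def)
  have "?e \<notin> edges T"
    using leaf.hyps edge_subset_verts by auto
  have "finite (X ?e)"
    using leaf.prems(1) by (simp add: edges_add_leaf)
  then obtain xs where xs: "set xs = X ?e" "distinct xs"
    using finite_distinct_list by blast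
  \<comment> \<open>The new leaf comes last, so it is an end of whichever path receives
    \<open>?q\<close>.\<close>
  let ?q = "xs @ [w]"
  have q: "set ?q \<inter> pverts ?H = {}" "pverts ?G = pverts ?H \<union> set ?q"
    and Xe: "u \<notin> X ?e" "w \<notin> X ?e"
  proof -
    have "X ?e \<inter> insert w (pverts T) = {}"
      using leaf.prems(1) by (simp add: edges_add_leaf)
    moreover have "X ?e \<inter> X e = {}" "w \<notin> X e" if "e \<in> edges T" for e
      using leaf.prems that \<open>?e \<notin> edges T\<close>
      by (auto simp: edges_add_leaf disjoint_family_on_def)
    ultimately show "set ?q \<inter> pverts ?H = {}" "u \<notin> X ?e" "w \<notin> X ?e"
      using leaf.hyps xs by (auto simp: expand_edges_simps)
    show "pverts ?G = pverts ?H \<union> set ?q"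
      using xs by (auto simp: expand_edges_simps edges_add_leaf)
  qed
  have sub: "pverts ?H \<subseteq> pverts ?G" "parcs ?H \<subseteq> parcs ?G"
    by (auto simp: expand_edges_simps edges_add_leaf)
  have vq: "vpath ?q (with_proj ?G)"
    using xs Xe leaf.hyps
    by (intro expand_edges_clique_vpath[of ?e]) (auto simp: edges_add_leaf)
  show ?case
  proof (cases "u \<in> leaves T")
    case True
    then obtain p where p: "p \<in> C" "u = hd p \<or> u = last p"
      using C(3) by blast
    define p' where "p' = (if u = last p then p else rev p)"
    have p': "p' = p \<or> p' = rev p" and "last p' = u" and "p' \<noteq> []"
      using p nonempty[OF p(1)] by (auto simp: p'_def last_rev)
    have "hd ?q \<in> X ?e \<union> {w}"
      using xs by (cases xs) auto
    then have "(last p', hd ?q) \<in> parcs ?G"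
      using \<open>last p' = u\<close> leaf.hyps Xe by (auto simp: expand_edges_simps edges_add_leaf)
    then have "path_covering ?G (insert (p' @ ?q) (C - {p}))"
      using C(1) p(1) sub p' \<open>pair_graph ?H\<close> vq q by (intro path_covering_extend)
    \<comment> \<open>The leaf \<open>w\<close> replaces the leaf \<open>u\<close>, so the number of
      paths must not grow.\<close>
    moreover have "card (insert (p' @ ?q) (C - {p})) \<le> card C"
      using card_Suc_Diff1[OF finC p(1)] card_insert_le_m1[of "card C" "C - {p}"] by simp
    moreover have "card (leaves ?T) = card (leaves T)"
      using L finL \<open>w \<notin> leaves T\<close> card_Suc_Diff1[OF finL True] by simp
    moreover have "\<exists>r\<in>insert (p' @ ?q) (C - {p}). v = hd r \<or> v = last r" if v: "v \<in> leaves ?T" for v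
    proof (cases "v = w")
      case False
      with v L have "v \<in> leaves T" "v \<noteq> u"
        by auto
      then obtain r where r: "r \<in> C" "v = hd r \<or> v = last r"
        using C(3) by blast
      show ?thesis
      proof (cases "r = p")
        case True
        \<comment> \<open>The leaf \<open>v\<close> differs from \<open>u\<close>, so it is the
          other end of \<open>p\<close>, which appending \<open>?q\<close> leaves untouched.\<close>
        have "v = hd p'"
          using r p nonempty[OF p(1)] \<open>v \<noteq> u\<close> True by (auto simp: p'_def hd_rev)
        then show ?thesis
          using \<open>p' \<noteq> []\<close> by auto
      qed (use r in auto)
    qed auto
    ultimately show ?thesis
      using C(2) by (intro exI[of _ "insert (p' @ ?q) (C - {p})"]) auto
  next
    case False
    \<comment> \<open>Here \<open>u\<close> need not be an end of a path; the additional path is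
      paid for by the additional leaf.\<close>
    have "path_covering ?G (insert ?q C)"
      using C(1) sub vq q by (intro path_covering_insert)
    moreover have "card (insert ?q C) \<le> card C + 1"
      using finC by (simp add: card_insert_if)
    moreover have "card (leaves ?T) = card (leaves T) + 1"
      using L finL \<open>w \<notin> leaves T\<close> False by simp
    moreover have "\<forall>v\<in>leaves ?T. \<exists>r\<in>insert ?q C. v = hd r \<or> v = last r"
      using L C(3) by auto
    ultimately show ?thesis
      using C(2) by (intro exI[of _ "insert ?q C"]) auto
  qed
qed

section \<open>The arcs used by a path covering, and the lower bound\<close>

definition covering_arcs :: "'a list set \<Rightarrow> ('a \<times> 'a) set" where
  "covering_arcs C = (\<Union>p\<in>C. set (vwalk_arcs p))"

locale covered_graph = pair_graph +
  fixes C :: "'a list set"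
  assumes covering: "path_covering G C"
begin

abbreviation D where "D \<equiv> covering_arcs C"

lemma
  shows finite_C: "finite C"
    and vpath_C: "p \<in> C \<Longrightarrow> vpath p (with_proj G)"
    and distinct_C: "p \<in> C \<Longrightarrow> distinct p"
    and cover_C: "(\<Union>p\<in>C. set p) = pverts G"
    and disjoint_C: "p \<in> C \<Longrightarrow> p' \<in> C \<Longrightarrow> x \<in> set p \<Longrightarrow> x \<in> set p' \<Longrightarrow> p = p'"
  using covering by (auto simp: path_covering_def vpath_def disjoint_family_on_def)

lemma D_subset: "D \<subseteq> parcs G"
  using vpath_C by (auto simp: covering_arcs_def vpath_def vwalk_def)

lemma finite_D: "finite D"
  using D_subset pair_finite_arcs by (rule finite_subset)

lemma D_iff: "(a, b) \<in> D \<longleftrightarrow> (\<exists>p\<in>C. \<exists>ys zs. p = ys @ a # b # zs)"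
  by (auto simp: covering_arcs_def mem_vwalk_arcs_iff)

text \<open>A vertex occurs once in the whole covering, so an arc of \<open>D\<close> into it starts
  at its list predecessor. Naming the prefix \<open>ys\<close> also shows where that predecessor
  lies.\<close>

lemma D_pred_unique:
  assumes "(a, x) \<in> D" and "p \<in> C" and "p = ys @ x # zs"
  shows "\<exists>ys'. ys = ys' @ [a]"
proof -
  obtain p' us vs where p': "p' \<in> C" "p' = us @ a # x # vs"
    using assms(1) D_iff by blast
  then have "p' = p"
    using assms(2,3) by (intro disjoint_C[of _ _ x]) auto
  then have "ys @ x # zs = (us @ [a]) @ x # vs"
    using assms(3) p'(2) by simp
  moreover have "x \<notin> set ys" "x \<notin> set zs"
    using distinct_C[OF assms(2)] assms(3) by auto
  ultimately have "ys = us @ [a]"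
    using append_Cons_eq_iff[of x ys zs "us @ [a]" vs] by auto
  then show ?thesis
    by blast
qed

lemma D_succ_unique:
  assumes "(x, a) \<in> D" and "p \<in> C" and "p = ys @ x # zs"
  shows "\<exists>zs'. zs = a # zs'"
proof -
  obtain p' us vs where p': "p' \<in> C" "p' = us @ x # a # vs"
    using assms(1) D_iff by blast
  then have "p' = p"
    using assms(2,3) by (intro disjoint_C[of _ _ x]) auto
  then have "ys @ x # zs = us @ x # a # vs"
    using assms(3) p'(2) by simp
  moreover have "x \<notin> set ys" "x \<notin> set zs"
    using distinct_C[OF assms(2)] assms(3) by auto
  ultimately have "zs = a # vs"
    using append_Cons_eq_iff[of x ys zs us "a # vs"] by auto
  then show ?thesis
    by blast
qed

lemma D_inj_snd: "(a, x) \<in> D \<Longrightarrow> (b, x) \<in> D \<Longrightarrow> a = b"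
  using D_pred_unique[of b x] D_iff[of a x]
  by (metis append.assoc append_Cons append_Nil last_snoc)

lemma D_inj_fst: "(x, a) \<in> D \<Longrightarrow> (x, b) \<in> D \<Longrightarrow> a = b"
  using D_succ_unique[of x b] D_iff[of x a] by (metis list.inject)

text \<open>Every vertex either begins its path or is entered by an arc of \<open>D\<close>.\<close>

lemma card_verts_le: "card (pverts G) \<le> card D + card C"
proof -
  have "pverts G \<subseteq> snd ` D \<union> hd ` C"
  proof
    fix x assume "x \<in> pverts G"
    then obtain p where p: "p \<in> C" "x \<in> set p"
      using cover_C by blast
    then obtain ys zs where eq: "p = ys @ x # zs"
      by (meson split_list)
    show "x \<in> snd ` D \<union> hd ` C"
    proof (cases ys rule: rev_cases)
      case Nil
      with eq p show ?thesis
        by force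
    next
      case (snoc us a)
      with eq p have "(a, x) \<in> D"
        by (auto simp: D_iff)
      then show ?thesis
        by force
    qed
  qed
  then have "card (pverts G) \<le> card (snd ` D \<union> hd ` C)"
    using finite_D finite_C by (intro card_mono) auto
  also have "\<dots> \<le> card (snd ` D) + card (hd ` C)"
    by (rule card_Un_le)
  also have "\<dots> \<le> card D + card C"
    using finite_D finite_C by (intro add_mono card_image_le)
  finally show ?thesis .
qed

text \<open>The first vertex of \<open>W\<close> on any path that meets \<open>W\<close> is not the head of an arc inside \<open>W\<close>.\<close>

lemma card_D_inside:
  assumes "W \<subseteq> pverts G" and "W \<noteq> {}"
  shows "card (D \<inter> W \<times> W) + 1 \<le> card W"
proof -
  have fin: "finite W"
    using assms(1) pair_finite_verts by (rule finite_subset)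
  obtain p where p: "p \<in> C" "\<exists>x\<in>set p. x \<in> W"
    using assms cover_C by blast
  obtain ys x zs where eq: "p = ys @ x # zs" and x: "x \<in> W" "\<forall>y\<in>set ys. y \<notin> W"
    using split_list_first_prop[OF p(2)] by blast
  have "snd ` (D \<inter> W \<times> W) \<subseteq> W - {x}"
    using D_pred_unique[OF _ p(1) eq] x(2) by fastforce
  moreover have "inj_on snd (D \<inter> W \<times> W)"
    using D_inj_snd by (auto simp: inj_on_def)
  ultimately have "card (D \<inter> W \<times> W) \<le> card (W - {x})"
    using fin by (metis card_image card_mono finite_Diff)
  then show ?thesis
    using card_Suc_Diff1[OF fin x(1)] by simp
qed

end

text \<open>Added vertices belong to one block only, so vertices common to two blocks are vertices
  of \<open>T\<close>; two of them determine the edge.\<close>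

lemma two_blocks_meet_once:
  assumes "pair_graph T" and "\<forall>e\<in>edges T. X e \<inter> pverts T = {}"
    and "disjoint_family_on X (edges T)"
    and "e \<in> edges T" "e' \<in> edges T" "a \<noteq> b"
    and "a \<in> e \<union> X e" "b \<in> e \<union> X e" "a \<in> e' \<union> X e'" "b \<in> e' \<union> X e'"
  shows "e = e'"
proof (rule ccontr)
  interpret pair_graph T by fact
  assume "e \<noteq> e'"
  then have "X e \<inter> X e' = {}"
    using assms(3-5) by (auto simp: disjoint_family_on_def)
  moreover have "X e \<inter> e' = {}" "X e' \<inter> e = {}"
    using assms(2,4,5) edge_subset_verts by blast+
  ultimately have "{a, b} \<subseteq> e" "{a, b} \<subseteq> e'"
    using assms(7-10) by auto
  moreover have "finite e" "finite e'" "card e = 2" "card e' = 2"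
    using assms(4,5) card_edge by (auto intro: card_ge_0_finite)
  ultimately have "e = {a, b}" "e' = {a, b}"
    using \<open>a \<noteq> b\<close> by (metis card_2_iff card_seteq card_2_iff' order_refl)+
  with \<open>e \<noteq> e'\<close> show False
    by simp
qed

lemma path_covering_lower:
  assumes grown: "leaf_grown T" and sparse: "two_sparse T"
    and X: "\<forall>e\<in>edges T. finite (X e) \<and> X e \<inter> pverts T = {}" "disjoint_family_on X (edges T)"
    and C: "path_covering (expand_edges T X) C"
  shows "card (leaves T) \<le> card C + 1"
proof -
  interpret T: pair_graph T
    using grown by (rule leaf_grown_pair_graph)
  let ?G = "expand_edges T X" and ?E = "edges T" and ?V = "pverts T"
  have "pair_graph ?G"
    using T.pair_graph X by (rule pair_graph_expand_edges)
  then interpret covered_graph ?G C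
    using C by (simp add: covered_graph_def covered_graph_axioms_def)
  define B where "B e = e \<union> X e" for e
  \<comment> \<open>The branch vertices of \<open>e\<close> that no covering arc inside the block
    touches; 2-sparseness allows at most one.\<close>
  define N where "N e = {v \<in> e. degree T v > 2 \<and> v \<notin> fst ` (D \<inter> B e \<times> B e) \<union> snd ` (D \<inter> B e \<times> B e)}" for e
  note finE = T.finite_edges and finV = T.pair_finite_verts
  have fine: "finite e" if "e \<in> ?E" for e
    using T.edge_subset_verts[OF that] finV by (rule finite_subset)
  \<comment> \<open>The right-hand side is the size of the block minus 1.\<close>
  have block_loss: "card (D \<inter> B e \<times> B e) + card (N e) \<le> card (X e) + 1" if e: "e \<in> ?E" for e
  proof -
    have eV: "e \<subseteq> ?V"
      using T.edge_subset_verts[OF e] .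
    have cardB: "card (B e) = card (X e) + 2"
      using X(1) e eV fine[OF e] T.card_edge[OF e] unfolding B_def
      by (subst card_Un_disjoint) auto
    have BG: "B e \<subseteq> pverts ?G"
      using e eV by (auto simp: B_def expand_edges_simps)
    have finB: "finite (B e)"
      using X(1) e fine by (simp add: B_def)
    show ?thesis
    proof (cases "N e = {}")
      case True
      then show ?thesis
        using card_D_inside[OF BG] cardB by fastforce
    next
      case False
      then obtain v where v: "v \<in> N e"
        by blast
      have "x = v" if x: "x \<in> N e" for x
      proof (rule ccontr)
        assume "x \<noteq> v"
        moreover have "x \<in> e" "v \<in> e" "degree T x > 2" "degree T v > 2"
          using x v by (auto simp: N_def)
        ultimately have "(x, v) \<in> parcs T"
          using e T.arcs_symmetric by (auto simp: edges_def)
        with \<open>degree T x > 2\<close> \<open>degree T v > 2\<close> sparse show False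
          by (auto simp: two_sparse_def)
      qed
      with v have Ne: "N e = {v}"
        by blast
      \<comment> \<open>Removing the untouched \<open>v\<close> loses no arc of \<open>D\<close>, so
        \<open>card_D_inside\<close> for the smaller set improves the bound by one.\<close>
      let ?W = "B e - {v}"
      have "v \<in> B e"
        using v by (auto simp: N_def B_def)
      then have cardW: "card ?W = card (X e) + 1"
        using cardB finB by simp
      then have "?W \<noteq> {}"
        by force
      then have "card (D \<inter> ?W \<times> ?W) + 1 \<le> card ?W"
        using BG by (intro card_D_inside) auto
      moreover have "D \<inter> B e \<times> B e = D \<inter> ?W \<times> ?W"
        using v by (force simp: N_def)
      ultimately show ?thesis
        using cardW Ne by simp
    qed
  qed
  have "card D \<le> card (\<Union>e\<in>?E. D \<inter> B e \<times> B e)"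
  proof (rule card_mono)
    show "finite (\<Union>e\<in>?E. D \<inter> B e \<times> B e)"
      using finE finite_D by auto
    show "D \<subseteq> (\<Union>e\<in>?E. D \<inter> B e \<times> B e)"
      using D_subset by (auto simp: expand_edges_simps B_def)
  qed
  also have "\<dots> \<le> (\<Sum>e\<in>?E. card (D \<inter> B e \<times> B e))"
    using finE by (rule card_UN_le)
  finally have "card D + (\<Sum>e\<in>?E. card (N e)) \<le> (\<Sum>e\<in>?E. card (D \<inter> B e \<times> B e) + card (N e))"
    by (simp add: sum.distrib)
  also have "\<dots> \<le> (\<Sum>e\<in>?E. card (X e) + 1)"
    by (rule sum_mono) (rule block_loss)
  finally have arcs: "card D + (\<Sum>e\<in>?E. card (N e)) \<le> (\<Sum>e\<in>?E. card (X e)) + card ?E"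
    by (simp add: sum_Suc)
  have "card (pverts ?G) = card ?V + card (\<Union>e\<in>?E. X e)"
    unfolding expand_edges_simps using finV finE X(1) by (intro card_Un_disjoint) auto
  also have "card (\<Union>e\<in>?E. X e) = (\<Sum>e\<in>?E. card (X e))"
    using finE X by (intro card_UN_disjoint') (auto simp: disjoint_family_on_def)
  finally have verts: "card (pverts ?G) = card ?V + (\<Sum>e\<in>?E. card (X e))" .
  \<comment> \<open>The same incidences as in \<open>N\<close>, collected by vertex, for double
    counting.\<close>
  define M where "M v = {e \<in> ?E. v \<in> N e}" for v
  have double_count: "(\<Sum>v\<in>?V. card (M v)) = (\<Sum>e\<in>?E. card (N e))"
  proof -
    have N: "N e = {v \<in> ?V. v \<in> N e}" if "e \<in> ?E" for e
      using T.edge_subset_verts[OF that] by (auto simp: N_def)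
    have "(\<Sum>v\<in>?V. card (M v)) = (\<Sum>v\<in>?V. \<Sum>e\<in>?E. if v \<in> N e then 1 else 0)"
      unfolding M_def using finE by (simp add: sum.If_cases Int_def)
    also have "\<dots> = (\<Sum>e\<in>?E. \<Sum>v\<in>?V. if v \<in> N e then 1 else 0)"
      by (rule sum.swap)
    also have "\<dots> = (\<Sum>e\<in>?E. card {v \<in> ?V. v \<in> N e})"
      using finV by (simp add: sum.If_cases Int_def)
    finally show ?thesis
      using N by simp
  qed
  have branch: "degree T v \<le> card (M v) + 2" if deg: "degree T v > 2" for v
  proof -
    \<comment> \<open>\<open>I\<close> and \<open>J\<close> are the blocks through which the
      covering enters and leaves \<open>v\<close>. Each has at most one element, since
      \<open>D\<close> has at most one arc into and one out of \<open>v\<close> and an arc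
      determines its block. The other edges at \<open>v\<close> are in \<open>M v\<close>.\<close>
    define I where "I = {e \<in> ?E. v \<in> B e \<and> (\<exists>a\<in>B e. (a, v) \<in> D)}"
    define J where "J = {e \<in> ?E. v \<in> B e \<and> (\<exists>a\<in>B e. (v, a) \<in> D)}"
    have once: "e = e'" if "e \<in> ?E" "e' \<in> ?E" "a \<noteq> b" "a \<in> B e" "b \<in> B e" "a \<in> B e'" "b \<in> B e'"
      for e e' a b
      using two_blocks_meet_once[OF T.pair_graph _ X(2), of e e' a b] X(1) that by (simp add: B_def)
    have loopfree: "a \<noteq> b" if "(a, b) \<in> D" for a b
      using that D_subset no_loops' by blast
    have "e = e'" if "e \<in> I" "e' \<in> I" for e e'
      using that D_inj_snd loopfree once unfolding I_def by blast
    then have "card I \<le> 1"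
      using finE by (auto simp: card_le_Suc0_iff_eq I_def)
    have "e = e'" if "e \<in> J" "e' \<in> J" for e e'
      using that D_inj_fst loopfree once unfolding J_def by blast
    then have "card J \<le> 1"
      using finE by (auto simp: card_le_Suc0_iff_eq J_def)
    have "degree T v = card {e \<in> ?E. v \<in> e}"
      by (simp add: T.card_incident_edges)
    also have "\<dots> \<le> card (M v \<union> (I \<union> J))"
    proof (rule card_mono)
      show "finite (M v \<union> (I \<union> J))"
        using finE by (simp add: M_def I_def J_def)
      show "{e \<in> ?E. v \<in> e} \<subseteq> M v \<union> (I \<union> J)"
        using deg by (force simp: M_def N_def I_def J_def)
    qed
    also have "\<dots> \<le> card (M v) + (card I + card J)"
      by (meson add_left_mono card_Un_le order_trans)
    finally show ?thesis
      using \<open>card I \<le> 1\<close> \<open>card J \<le> 1\<close> by simp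
  qed
  \<comment> \<open>The additive form of \<open>d - 2\<close> avoids truncated subtraction. The
    extra 1 makes a leaf attain equality, and summing it over all vertices counts the
    leaves.\<close>
  have local_bound: "degree T v + (if degree T v = 1 then 1 else 0) \<le> card (M v) + 2"
    if v: "v \<in> ?V" for v
    using branch[of v] by (cases "degree T v > 2") auto
  have "(\<Sum>v\<in>?V. degree T v) + card (leaves T) =
      (\<Sum>v\<in>?V. degree T v + (if degree T v = 1 then 1 else 0))"
    using finV by (simp add: sum.distrib leaves_def sum.If_cases Int_def)
  also have "\<dots> \<le> (\<Sum>v\<in>?V. card (M v) + 2)"
    by (rule sum_mono) (rule local_bound)
  also have "\<dots> = (\<Sum>e\<in>?E. card (N e)) + 2 * card ?V"
    by (simp only: sum.distrib sum_constant double_count of_nat_id mult.commute)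
  finally have "card (parcs T) + card (leaves T) \<le> (\<Sum>e\<in>?E. card (N e)) + 2 * card ?V"
    by (simp only: T.sum_degree)
  \<comment> \<open>As \<open>T\<close> has one vertex more than edges and twice as many arcs as
    edges, the last bound says that the sum of the \<open>card (N e)\<close> is at least the number
    of leaves minus 2; \<open>arcs\<close>, \<open>verts\<close> and \<open>card_verts_le\<close>
    make \<open>card C\<close> exceed that sum.\<close>
  then show ?thesis
    using arcs verts card_verts_le leaf_grown_card[OF grown] by linarith
qed

section \<open>The path covering number of a clique expansion\<close>

theorem theorem22:
  fixes T G :: "'a pair_pre_digraph" and l :: nat
  assumes "undirected_tree T" and "two_sparse T"
    and "card (leaves T) = l" and "l \<ge> 2"
    and "G \<in> clique_expansions T"
  shows "path_covering_number G = l - 1"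
proof -
  \<comment> \<open>A leaf has an incident arc, which rules out the one-vertex tree.\<close>
  obtain v where "v \<in> leaves T"
    using assms(3,4) by fastforce
  then have "parcs T `` {v} \<noteq> {}"
    unfolding leaves_def degree_eq_card_image by auto
  then have grown: "leaf_grown T"
    using assms(1) by (intro undirected_tree_leaf_grown) auto
  obtain X where G: "G = expand_edges T X"
    and X: "\<forall>e\<in>edges T. finite (X e) \<and> X e \<inter> pverts T = {}" "disjoint_family_on X (edges T)"
    using assms(5) by (auto simp: clique_expansions_def)
  have lower: "l - 1 \<le> card C" if "path_covering G C" for C
    using path_covering_lower[OF grown assms(2) X] that assms(3) G by fastforce
  obtain C where C: "path_covering G C" "card C + 1 \<le> l"
    using path_covering_upper[OF grown X] assms(3) G by blast
  with lower[OF C(1)] have "card C = l - 1"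
    by simp
  with C(1) lower show ?thesis
    unfolding path_covering_number_def by (intro Least_equality) auto
qed

end
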